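(* Let $\mathbf{D}=(d_1,\dots,d_n)$ be a sequence of positive integers such that $\|\mathbf{D}\|_1=\sum_{\ell=1}^n d_\ell$ is even. Let $1<p\leq\infty$ be a parameter. Part (a). Assume that $$\|2+\mathbf{D}\|_p\leq n^{\frac12+\frac1{2p}}.$$ Then there is a simple graph $G$ with degree sequence $\mathbf{D}$. Part (b). Let $G$ be any simple graph with degree sequence $\mathbf{D}$. Assume that $d\geq 2$ is an even integer satisfying $$4d^{1-\frac1p}\|\mathbf{D}\|_p\leq\|\mathbf{D}\|_1.$$ Then the pair $(G,d)$ is DPG-graphic, and consequently $\mathbf{D}\circ d$ is graphic.
   Context: For a real vector $\mathbf{v}=(v_1,\dots,v_n)$, $\|\mathbf{v}\|_p=\left(\sum_{\ell=1}^n |v_\ell|^p\right)^{1/p}$ for $1\leq p<\infty$ and $\|\mathbf{v}\|_\infty=\max_\ell |v_\ell|$; when $p=\infty$, $1/p$ is interpreted as $0$. The sequence $2+\mathbf{D}$ is $(2+d_1,\dots,2+d_n)$, and $\mathbf{D}\circ d$ is the sequence $(d_1,\dots,d_n,d)$ obtained by concatenating $d$ to the end of $\mathbf{D}$. A simple graph has no loops and no parallel edges. A graph on $n$ vertices labeled $1,\dots,n$ has degree sequence $\mathbf{D}$ if vertex $\ell$ has degree $d_\ell$ for every $\ell$. A sequence of nonnegative integers is graphic if it is the degree sequence of some simple graph. A matching is a set of pairwise non-adjacent edges. For a simple graph $G$ and an even integer $d\geq 2$, the pair $(G,d)$ is called DPG-graphic if $G$ contains a matching of size $d/2$. *)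

theory Defs
  imports Complex_Main "HOL-Library.Extended_Real"
begin

text \<open>
  The exponent ranges over \<open>1 \<le> p \<le> \<infinity>\<close>, hence the type \<^typ>\<open>ereal\<close>. The maximum is meant for
  nonempty vectors. The convention \<open>1 / \<infinity> = 0\<close> is that of \<^typ>\<open>ereal\<close> (see \<open>recip_infinity\<close>).
\<close>

definition pnorm :: "ereal \<Rightarrow> real list \<Rightarrow> real" where
  "pnorm p v =
     (if p = \<infinity> then Max (abs ` set v)
      else (\<Sum>x\<leftarrow>v. \<bar>x\<bar> powr real_of_ereal p) powr (1 / real_of_ereal p))"

definition recip :: "ereal \<Rightarrow> real" where
  "recip p = real_of_ereal (1 / p)"

lemma recip_infinity: "recip \<infinity> = 0"
  by (simp add: recip_def)

lemma recip_ereal: "p \<noteq> 0 \<Longrightarrow> recip (ereal p) = 1 / p"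
  by (simp add: recip_def one_ereal_def)

lemma pnorm_1: "pnorm 1 (map real D) = real (sum_list D)"
proof -
  have "(\<Sum>x\<leftarrow>map real D. \<bar>x\<bar> powr 1) = real (sum_list D)"
    by (induction D) auto
  then show ?thesis
    by (simp add: pnorm_def)
qed

text \<open>
  A graph is a pair of its vertex set and its set of edges, an edge of a simple graph being the
  two-element set of its endpoints. Degree sequences are lists, so the vertices of a graph on
  \<open>n\<close> labeled vertices are numbered \<open>0, \<dots>, n - 1\<close> rather than \<open>1, \<dots>, n\<close>.
\<close>

type_synonym 'a ugraph = "'a set \<times> 'a set set"

definition simple_graph :: "'a ugraph \<Rightarrow> bool" where
  "simple_graph G \<longleftrightarrow> finite (fst G) \<and> (\<forall>e\<in>snd G. e \<subseteq> fst G \<and> card e = 2)"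

definition vertex_degree :: "'a ugraph \<Rightarrow> 'a \<Rightarrow> nat" where
  "vertex_degree G v = card {e \<in> snd G. v \<in> e}"

definition has_degree_sequence :: "nat ugraph \<Rightarrow> nat list \<Rightarrow> bool" where
  "has_degree_sequence G D \<longleftrightarrow>
     fst G = {..<length D} \<and> (\<forall>l<length D. vertex_degree G l = D ! l)"

definition graphic :: "nat list \<Rightarrow> bool" where
  "graphic D \<longleftrightarrow> (\<exists>G. simple_graph G \<and> has_degree_sequence G D)"

definition is_matching :: "'a ugraph \<Rightarrow> 'a set set \<Rightarrow> bool" where
  "is_matching G M \<longleftrightarrow> M \<subseteq> snd G \<and> pairwise disjnt M"

definition dpg_graphic :: "'a ugraph \<Rightarrow> nat \<Rightarrow> bool" where
  "dpg_graphic G d \<longleftrightarrow>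
     simple_graph G \<and> even d \<and> 2 \<le> d \<and> (\<exists>M. is_matching G M \<and> card M = d div 2)"

end

theory Submission
  imports Defs "HOL-Analysis.Convex"
begin

text \<open>
  By Hoelder's inequality, any \<open>k\<close> entries of \<open>v\<close> sum to at most \<open>k\<close> to the power \<open>1 - 1/p\<close> times
  the \<open>p\<close>-norm of \<open>v\<close>. For part (a) this is at most \<open>max (k\<^sup>2) n\<close> when \<open>v = 2 + D\<close>, so any \<open>k\<close>
  degrees sum to at most \<open>k\<^sup>2 + n - 2k = k(k - 1) + (n - k)\<close>; as all degrees are positive, this is
  stronger than the Erdos-Gallai condition. For part (b), the vertices covered by a maximal
  matching form a vertex cover. If the matching had fewer than \<open>d/2\<close> edges, the cover would have
  fewer than \<open>d\<close> vertices, and by Hoelder's inequality their degrees would sum to less than the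
  number of edges. Finally, replacing the edges of a matching of size \<open>d/2\<close> by edges from its
  endpoints to a new vertex realizes \<open>D\<close> followed by \<open>d\<close>.
\<close>

section \<open>Degrees in simple graphs\<close>

lemma simple_graph_finite_edges: "simple_graph (V, E) \<Longrightarrow> finite E"
  unfolding simple_graph_def by (metis finite_Pow_iff fst_conv snd_conv PowI finite_subset subsetI)

lemma simple_graph_insert:
  "simple_graph (V, E) \<Longrightarrow> a \<in> V \<Longrightarrow> b \<in> V \<Longrightarrow> a \<noteq> b \<Longrightarrow> simple_graph (V, insert {a, b} E)"
  by (auto simp: simple_graph_def)

lemma simple_graph_mono: "simple_graph (V, E) \<Longrightarrow> F \<subseteq> E \<Longrightarrow> simple_graph (V, F)"
  by (auto simp: simple_graph_def)

lemma simple_graph_edge: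
  assumes "simple_graph (V, E)" "{u, v} \<in> E"
  shows "u \<in> V" "v \<in> V" "u \<noteq> v"
  using assms by (auto simp: simple_graph_def dest!: bspec[of E _ "{u, v}"])

text \<open>A switch deletes and adds a few edges; this rule and its counterpart for removal allow
  the resulting degrees to be computed one edge at a time.\<close>

lemma vertex_degree_insert:
  "finite E \<Longrightarrow> e \<notin> E \<Longrightarrow>
    vertex_degree (V, insert e E) v = vertex_degree (V, E) v + of_bool (v \<in> e)"
proof -
  assume "finite E" "e \<notin> E"
  moreover have "{e' \<in> insert e E. v \<in> e'} =
      (if v \<in> e then insert e {e' \<in> E. v \<in> e'} else {e' \<in> E. v \<in> e'})"
    by auto
  ultimately show ?thesis
    by (simp add: vertex_degree_def)
qed

lemma vertex_degree_remove:
  assumes "finite E" "e \<in> E"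
  shows "vertex_degree (V, E - {e}) v = vertex_degree (V, E) v - of_bool (v \<in> e)"
  using vertex_degree_insert[of "E - {e}" e V v] assms by (simp add: insert_absorb)

lemma vertex_degree_pos:
  assumes "finite E" "e \<in> E" "v \<in> e"
  shows "0 < vertex_degree (V, E) v"
  using assms by (auto simp: vertex_degree_def card_gt_0_iff)

text \<open>Sending \<open>u\<close> to \<open>{u, v}\<close> is a bijection from the neighbours of
  \<open>v\<close> to the edges at \<open>v\<close>. The switching argument compares neighbourhoods,
  while degrees count edges.\<close>

lemma vertex_degree_eq_card_neighbours:
  assumes "simple_graph (V, E)"
  shows "vertex_degree (V, E) v = card {u. {u, v} \<in> E}"
proof -
  have "bij_betw (\<lambda>u. {u, v}) {u. {u, v} \<in> E} {e \<in> E. v \<in> e}"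
  proof (rule bij_betw_imageI)
    show "inj_on (\<lambda>u. {u, v}) {u. {u, v} \<in> E}"
      by (auto simp: inj_on_def doubleton_eq_iff)
    show "(\<lambda>u. {u, v}) ` {u. {u, v} \<in> E} = {e \<in> E. v \<in> e}"
    proof (intro equalityI subsetI)
      fix e assume e: "e \<in> {e \<in> E. v \<in> e}"
      then have "card e = 2" using assms by (auto simp: simple_graph_def)
      then obtain x y where "e = {x, y}" by (auto simp: card_2_iff)
      with e show "e \<in> (\<lambda>u. {u, v}) ` {u. {u, v} \<in> E}"
        by (auto simp: insert_commute)
    qed auto
  qed
  then show ?thesis
    unfolding vertex_degree_def by (simp add: bij_betw_same_card)
qed

lemma finite_neighbours: "simple_graph (V, E) \<Longrightarrow> finite {u. {u, v} \<in> E}"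
  by (rule finite_subset[of _ V]) (auto simp: simple_graph_def)

text \<open>Handshake lemma, by counting the incidences between vertices and edges in two
  ways.\<close>

lemma sum_vertex_degree:
  assumes "simple_graph (V, E)"
  shows "(\<Sum>v\<in>V. vertex_degree (V, E) v) = 2 * card E"
proof -
  have "\<forall>e\<in>E. card {v \<in> V. v \<in> e} = 2"
    using assms by (auto simp: simple_graph_def Collect_conj_eq Int_absorb1)
  then show ?thesis
    using assms unfolding vertex_degree_def snd_conv
    using sum_multicount[of V E "\<lambda>v e. v \<in> e" 2] simple_graph_finite_edges[OF assms]
    by (simp add: simple_graph_def)
qed

section \<open>The sufficiency half of the Erdos-Gallai theorem\<close>

text \<open>
  The switching argument of Tripathi, Venugopalan and West: the vertices are saturated in order of
  decreasing degree. \<open>A\<close> is the set of saturated vertices, and the vertices outside of \<open>B\<close> are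
  kept independent. When no switch raises the degree of the next vertex \<open>r\<close>, the vertices of
  \<open>insert r A\<close> form a clique and every other vertex \<open>k\<close> has degree at least
  \<open>min (Suc (card A)) (d k)\<close>, so the Erdos-Gallai inequality for \<open>insert r A\<close> leaves no deficiency
  at \<open>r\<close>.
\<close>

definition partial_realization ::
    "'a set \<Rightarrow> ('a \<Rightarrow> nat) \<Rightarrow> 'a set \<Rightarrow> 'a set \<Rightarrow> 'a set set \<Rightarrow> bool" where
  "partial_realization V d A B E \<longleftrightarrow>
     simple_graph (V, E) \<and> (\<forall>v\<in>V. vertex_degree (V, E) v \<le> d v) \<and>
     (\<forall>v\<in>A. vertex_degree (V, E) v = d v) \<and> (\<forall>e\<in>E. e \<inter> B \<noteq> {})"

lemma realize_next_vertex:
  fixes d :: "'a \<Rightarrow> nat"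
  assumes "finite V" and A: "A \<subseteq> V" and r: "r \<in> V" "r \<notin> A"
    and dom: "\<And>a. a \<in> A \<Longrightarrow> d r \<le> d a"
    and even: "even (\<Sum>v\<in>V. d v)"
    and EG: "(\<Sum>v\<in>insert r A. d v) \<le> card A * Suc (card A) +
               (\<Sum>v\<in>V - insert r A. min (Suc (card A)) (d v))"
    and ex: "partial_realization V d A A E0"
  shows "\<exists>E. partial_realization V d (insert r A) (insert r A) E"
proof -
  define B where "B = insert r A"
  let ?Q = "partial_realization V d A B"
  let ?deg = "\<lambda>E. vertex_degree (V, E)"
  \<comment> \<open>Letting edges meet \<open>B\<close> instead of \<open>A\<close> permits new
    edges at \<open>r\<close>. The degree of \<open>r\<close> is bounded by \<open>d r\<close>, so
    some such realization maximizes it; every switch below contradicts this maximality through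
    \<open>improve\<close>.\<close>
  have "?Q E0" using ex unfolding partial_realization_def B_def by auto
  moreover have "\<forall>E. ?Q E \<longrightarrow> ?deg E r < Suc (d r)"
    using r by (auto simp: partial_realization_def less_Suc_eq_le)
  ultimately obtain E where Q: "?Q E" and mx: "\<And>E'. ?Q E' \<Longrightarrow> ?deg E' r \<le> ?deg E r"
    using ex_has_greatest_nat[of ?Q E0 "\<lambda>E. ?deg E r"] by blast
  have sg: "simple_graph (V, E)" and le: "\<And>v. v \<in> V \<Longrightarrow> ?deg E v \<le> d v"
    and eq: "\<And>v. v \<in> A \<Longrightarrow> ?deg E v = d v" and meet: "\<And>e. e \<in> E \<Longrightarrow> e \<inter> B \<noteq> {}"
    using Q by (auto simp: partial_realization_def)
  note fin = simple_graph_finite_edges[OF sg]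
  note nbr = simple_graph_edge[OF sg]
  have pos: "0 < ?deg E u" "0 < ?deg E v" if "{u, v} \<in> E" for u v
    using vertex_degree_pos[OF fin that] by auto
  have "?deg E r = d r"
  proof (rule ccontr)
    assume "?deg E r \<noteq> d r"
    then have lt: "?deg E r < d r" using le r by (simp add: le_neq_implies_less)
    have improve: False if sg': "simple_graph (V, E')"
        and le': "\<And>v. v \<in> V \<Longrightarrow> v \<noteq> r \<Longrightarrow> v \<notin> A \<Longrightarrow> ?deg E' v \<le> d v"
        and eq': "\<And>v. v \<in> A \<Longrightarrow> ?deg E' v = ?deg E v"
        and more: "?deg E r < ?deg E' r" and "?deg E' r \<le> d r"
        and meet': "\<And>e. e \<in> E' \<Longrightarrow> e \<in> E \<or> e \<inter> B \<noteq> {}" for E'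
    proof -
      have "?deg E' v \<le> d v" if "v \<in> V" for v
        using le'[OF that] eq'[of v] eq[of v] \<open>?deg E' r \<le> d r\<close> by (cases "v \<in> A"; cases "v = r") simp_all
      moreover have "?deg E' v = d v" if "v \<in> A" for v
        using eq'[OF that] eq[OF that] by simp
      moreover have "e \<inter> B \<noteq> {}" if "e \<in> E'" for e
        using meet'[OF that] meet[of e] by argo
      ultimately have "?Q E'" using sg' unfolding partial_realization_def by simp
      from mx[OF this] more show False by simp
    qed
    \<comment> \<open>Two nonadjacent deficient vertices could simply be joined.\<close>
    have adj_deficient: "{k, r} \<in> E" if "k \<in> V" "k \<noteq> r" "?deg E k < d k" for k
    proof (rule ccontr)
      assume n: "{k, r} \<notin> E"
      have "k \<notin> A" using eq that by auto
      show False
        by (rule improve[of "insert {k, r} E"])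
          (use that n fin le lt r \<open>k \<notin> A\<close> in
            \<open>auto simp: vertex_degree_insert simple_graph_insert[OF sg] B_def\<close>)
    qed
    \<comment> \<open>because \<open>a\<close> currently has larger degree than \<open>r\<close>\<close>
    have private_nbr: "\<exists>u. {u, a} \<in> E \<and> u \<noteq> r \<and> {u, r} \<notin> E" if "a \<in> A" for a
    proof (rule ccontr)
      assume "\<nexists>u. {u, a} \<in> E \<and> u \<noteq> r \<and> {u, r} \<notin> E"
      then have sub: "{u. {u, a} \<in> E} - {r} \<subseteq> {u. {u, r} \<in> E} - {a}"
        using nbr(3) by blast
      have "card ({u. {u, a} \<in> E} - {r}) \<le> card ({u. {u, r} \<in> E} - {a})"
        using sub finite_neighbours[OF sg] by (intro card_mono) auto
      \<comment> \<open>Adjacency is symmetric, so deleting \<open>r\<close> from one neighbourhood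
        and \<open>a\<close> from the other lowers both cardinalities by the same amount.\<close>
      moreover have "{a, r} \<in> E \<longleftrightarrow> {r, a} \<in> E" by (simp add: insert_commute)
      ultimately have "?deg E a \<le> ?deg E r"
        using finite_neighbours[OF sg] pos[of a r]
        by (cases "{a, r} \<in> E") (auto simp: vertex_degree_eq_card_neighbours[OF sg])
      with eq[OF that] dom[OF that] lt show False by simp
    qed
    have adj_A: "{a, r} \<in> E" if a: "a \<in> A" for a
    proof (rule ccontr)
      assume n: "{a, r} \<notin> E"
      obtain u where u: "{u, a} \<in> E" "u \<noteq> r" "{u, r} \<notin> E" using private_nbr a by blast
      have aV: "a \<in> V" "a \<noteq> r" and uV: "u \<in> V" "u \<noteq> a"
        using a A r nbr[OF u(1)] by auto
      show False
      proof (cases "Suc (?deg E r) = d r")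
        case False
        \<comment> \<open>Here \<open>r\<close> lacks at least two edges. Rerouting
          \<open>{u, a}\<close> through \<open>r\<close> raises the degree of \<open>r\<close> by
          two and leaves \<open>u\<close> and \<open>a\<close> unchanged.\<close>
        let ?E = "insert {u, r} (insert {a, r} (E - {{u, a}}))"
        have deg: "?deg ?E v = ?deg E v + (if v = r then 2 else 0)" for v
          using fin u n aV uV pos[OF u(1)]
          by (auto simp: vertex_degree_insert vertex_degree_remove doubleton_eq_iff)
        show False
          by (rule improve[of ?E])
            (use aV uV u r le lt False in \<open>auto simp: deg B_def intro!: simple_graph_insert
              intro: simple_graph_mono[OF sg]\<close>)
      next
        case True
        \<comment> \<open>The same switch would now overshoot by one, so an edge
          \<open>{k, r}\<close> is given up as well, with \<open>k\<close> deficient and hence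
          outside \<open>A\<close>. Parity supplies \<open>k\<close>: otherwise the even sum of
          \<open>d\<close> would exceed the even degree sum by exactly one.\<close>
        have "\<exists>k\<in>V. k \<noteq> r \<and> ?deg E k < d k"
        proof (rule ccontr)
          assume "\<not> (\<exists>k\<in>V. k \<noteq> r \<and> ?deg E k < d k)"
          then have "?deg E k = d k" if "k \<in> V - {r}" for k
            using le[of k] that by (auto simp: le_less)
          then have "(\<Sum>v\<in>V. d v) = Suc (\<Sum>v\<in>V. ?deg E v)"
            using True by (simp add: sum.remove[OF \<open>finite V\<close> r(1)])
          with even sum_vertex_degree[OF sg] show False by simp
        qed
        then obtain k where k: "k \<in> V" "k \<noteq> r" "?deg E k < d k" by blast
        have kr: "{k, r} \<in> E" using adj_deficient k by blast
        have kn: "k \<notin> A" "k \<noteq> u" "k \<noteq> a" using eq k kr u n by auto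
        let ?E = "insert {u, r} (insert {a, r} (E - {{u, a}} - {{k, r}}))"
        have deg: "?deg ?E v = (if v = r then Suc (?deg E v)
            else if v = k then ?deg E v - 1 else ?deg E v)" for v
          using fin u n aV uV pos[OF u(1)] kr kn k pos[OF kr]
          by (auto simp: vertex_degree_insert vertex_degree_remove doubleton_eq_iff)
        show False
          by (rule improve[of ?E])
            (use aV uV u r le lt kn in \<open>auto simp: deg B_def le_diff_conv intro!: simple_graph_insert
              intro: simple_graph_mono[OF sg] le_SucI\<close>)
      qed
    qed
    have outside: "min (Suc (card A)) (d k) \<le> ?deg E k" if k: "k \<in> V - B" for k
    proof (rule ccontr)
      assume "\<not> min (Suc (card A)) (d k) \<le> ?deg E k"
      then have small: "?deg E k < Suc (card A)" "?deg E k < d k" by auto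
      have kV: "k \<in> V" "k \<noteq> r" "k \<notin> A" using k by (auto simp: B_def)
      then have kr: "{k, r} \<in> E" using adj_deficient small by blast
      have "\<exists>a\<in>A. {a, k} \<notin> E"
      proof (rule ccontr)
        assume "\<not> (\<exists>a\<in>A. {a, k} \<notin> E)"
        then have "insert r A \<subseteq> {u. {u, k} \<in> E}" using kr by (auto simp: insert_commute)
        then have "card (insert r A) \<le> ?deg E k"
          unfolding vertex_degree_eq_card_neighbours[OF sg]
          by (intro card_mono finite_neighbours[OF sg])
        with small r A \<open>finite V\<close> show False by (simp add: finite_subset)
      qed
      then obtain a where a: "a \<in> A" "{a, k} \<notin> E" by blast
      obtain u where u: "{u, a} \<in> E" "u \<noteq> r" "{u, r} \<notin> E" using private_nbr a by blast
      have aV: "a \<in> V" "a \<noteq> r" and uV: "u \<in> V" "u \<noteq> a"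
        using a A r nbr[OF u(1)] by auto
      have ku: "k \<noteq> u" "k \<noteq> a" using kr u kV a by auto
      \<comment> \<open>Only \<open>r\<close> and \<open>k\<close> gain an edge, and both are
        deficient; \<open>u\<close> and \<open>a\<close> break even.\<close>
      let ?E = "insert {u, r} (insert {a, k} (E - {{u, a}}))"
      have deg: "?deg ?E v = ?deg E v + of_bool (v = r \<or> v = k)" for v
        using fin u a aV uV pos[OF u(1)] kr ku kV
        by (auto simp: vertex_degree_insert vertex_degree_remove doubleton_eq_iff)
      show False
        by (rule improve[of ?E])
          (use aV uV u r le lt kV ku a small in \<open>auto simp: deg B_def intro!: simple_graph_insert
            intro: simple_graph_mono[OF sg]\<close>)
    qed
    have clique_A: "{a, b} \<in> E" if a: "a \<in> A" and b: "b \<in> A" and "a \<noteq> b" for a b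
    proof (rule ccontr)
      assume n: "{a, b} \<notin> E"
      obtain u where u: "{u, a} \<in> E" "u \<noteq> r" "{u, r} \<notin> E" using private_nbr a by blast
      obtain w where w: "{w, b} \<in> E" "w \<noteq> r" "{w, r} \<notin> E" using private_nbr b by blast
      have V: "a \<in> V" "a \<noteq> r" "u \<in> V" "u \<noteq> a" "b \<in> V" "b \<noteq> r" "w \<in> V" "w \<noteq> b"
        using a b A r nbr[OF u(1)] nbr[OF w(1)] by auto
      have uA: "u \<notin> A" "w \<notin> A" using adj_A u w by auto
      then have ne: "u \<noteq> b" "w \<noteq> a" using a b by auto
      \<comment> \<open>The two private neighbours may coincide. Then \<open>u\<close> loses two
        edges and gains one, and with truncated subtraction this amounts to a loss of one only if
        its degree is at least 2.\<close>
      have ub: "?deg E u \<ge> 2" if "u = w"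
      proof -
        have "{a, b} \<subseteq> {v. {v, u} \<in> E}"
          using u w that by (auto simp: insert_commute)
        then have "card {a, b} \<le> card {v. {v, u} \<in> E}"
          by (intro card_mono finite_neighbours[OF sg])
        with \<open>a \<noteq> b\<close> show ?thesis by (simp add: vertex_degree_eq_card_neighbours[OF sg])
      qed
      \<comment> \<open>This raises \<open>r\<close> by one at the expense of \<open>w\<close>. The
        loss is harmless because \<open>w\<close> is not saturated: by \<open>adj_A\<close>, a
        vertex of \<open>A\<close> would be adjacent to \<open>r\<close>.\<close>
      let ?E = "insert {a, b} (insert {u, r} (E - {{u, a}} - {{w, b}}))"
      have deg: "?deg ?E v = (if v = r then Suc (?deg E v)
          else if v = w then ?deg E v - 1 else ?deg E v)" for v
        using fin u w n V ne pos[OF u(1)] pos[OF w(1)] \<open>a \<noteq> b\<close> r(1) ub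
        by (auto simp: vertex_degree_insert vertex_degree_remove doubleton_eq_iff)
      show False
        by (rule improve[of ?E])
          (use a b V u w r le lt uA \<open>a \<noteq> b\<close> in \<open>auto simp: deg B_def le_diff_conv
            intro!: simple_graph_insert intro: simple_graph_mono[OF sg] le_SucI\<close>)
    qed
    have finB: "finite B" and cB: "card B = Suc (card A)" and BV: "B \<subseteq> V"
      using A r \<open>finite V\<close> by (auto simp: B_def finite_subset)
    have clique: "{u, v} \<in> E" if "u \<in> B" "v \<in> B" "u \<noteq> v" for u v
      using that adj_A[of u] adj_A[of v] clique_A[of u v] unfolding B_def
      by (auto simp: insert_commute[of r])
    have degB: "?deg E v = card A + card {u \<in> V - B. {u, v} \<in> E}" if "v \<in> B" for v
    proof -
      have "{u. {u, v} \<in> E} = (B - {v}) \<union> {u \<in> V - B. {u, v} \<in> E}"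
        using clique[OF _ that] nbr(1,3)[of _ v] by blast
      then have "?deg E v = card ((B - {v}) \<union> {u \<in> V - B. {u, v} \<in> E})"
        by (simp add: vertex_degree_eq_card_neighbours[OF sg])
      also have "\<dots> = card (B - {v}) + card {u \<in> V - B. {u, v} \<in> E}"
        using finB \<open>finite V\<close> by (intro card_Un_disjoint) auto
      finally show ?thesis using that finB cB by simp
    qed
    have degout: "card {v \<in> B. {u, v} \<in> E} = ?deg E u" if "u \<in> V - B" for u
    proof -
      have "{v \<in> B. {u, v} \<in> E} = {v. {v, u} \<in> E}"
        using that meet by (fastforce simp: insert_commute)
      then show ?thesis by (simp add: vertex_degree_eq_card_neighbours[OF sg])
    qed
    \<comment> \<open>Double counting of the edges between \<open>B\<close> and its complement. No
      edge avoids \<open>B\<close>, so an outside vertex has all of its edges into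
      \<open>B\<close>.\<close>
    have "(\<Sum>v\<in>B. ?deg E v) = card A * card B + (\<Sum>v\<in>B. card {u \<in> V - B. {u, v} \<in> E})"
      by (simp add: degB sum.distrib)
    also have "(\<Sum>v\<in>B. card {u \<in> V - B. {u, v} \<in> E}) = (\<Sum>u\<in>V - B. ?deg E u)"
      using finB \<open>finite V\<close> degout by (intro sum_multicount_gen) auto
    finally have "(\<Sum>v\<in>B. ?deg E v) = card A * card B + (\<Sum>u\<in>V - B. ?deg E u)" .
    moreover have "(\<Sum>u\<in>V - B. min (Suc (card A)) (d u)) \<le> (\<Sum>u\<in>V - B. ?deg E u)"
      by (intro sum_mono outside)
    ultimately have "(\<Sum>v\<in>B. d v) \<le> (\<Sum>v\<in>B. ?deg E v)"
      using EG cB unfolding B_def[symmetric] by simp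
    moreover have "(\<Sum>v\<in>B. ?deg E v) < (\<Sum>v\<in>B. d v)"
      using lt le BV finB by (intro sum_strict_mono_ex1) (auto simp: B_def)
    ultimately show False by simp
  qed
  then have "partial_realization V d (insert r A) (insert r A) E"
    using Q by (auto simp: partial_realization_def B_def)
  then show ?thesis ..
qed

text \<open>Induction on the number of saturated vertices, from the edgeless graph until all of
  \<open>V\<close> is saturated. Stating the inequality for every vertex set replaces sorting the
  degrees.\<close>

theorem erdos_gallai_sufficient:
  fixes d :: "'a \<Rightarrow> nat"
  assumes "finite V" and even: "even (\<Sum>v\<in>V. d v)"
    and EG: "\<And>A. A \<subseteq> V \<Longrightarrow>
      (\<Sum>v\<in>A. d v) \<le> card A * (card A - 1) + (\<Sum>v\<in>V - A. min (card A) (d v))"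
  shows "\<exists>E. simple_graph (V, E) \<and> (\<forall>v\<in>V. vertex_degree (V, E) v = d v)"
proof -
  \<comment> \<open>The dominance clause yields \<open>d r \<le> d a\<close> for the next vertex,
    and it survives because \<open>r\<close> has the largest target degree outside
    \<open>A\<close>.\<close>
  have "\<exists>A\<subseteq>V. card A = k \<and> (\<forall>a\<in>A. \<forall>b\<in>V - A. d b \<le> d a) \<and> (\<exists>E. partial_realization V d A A E)"
    if "k \<le> card V" for k
    using that
  proof (induction k)
    case 0
    have "partial_realization V d {} {} {}"
      using \<open>finite V\<close> by (simp add: partial_realization_def simple_graph_def vertex_degree_def)
    then show ?case by (intro exI[of _ "{}"]) auto
  next
    case (Suc k)
    then obtain A E where A: "A \<subseteq> V" "card A = k" and dom: "\<forall>a\<in>A. \<forall>b\<in>V - A. d b \<le> d a"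
      and E: "partial_realization V d A A E"
      by auto
    have finA: "finite A" using A \<open>finite V\<close> finite_subset by blast
    have ne: "V - A \<noteq> {}" using Suc.prems A finA
      by (metis Diff_eq_empty_iff card_mono not_less_eq_eq)
    have "\<exists>r\<in>V - A. \<forall>b\<in>V - A. d b \<le> d r"
    proof -
      have "Max (d ` (V - A)) \<in> d ` (V - A)" using ne \<open>finite V\<close> by (intro Max_in) auto
      then obtain r where "r \<in> V - A" "d r = Max (d ` (V - A))" by auto
      then show ?thesis using \<open>finite V\<close> by (intro bexI[of _ r]) auto
    qed
    then obtain r where r: "r \<in> V" "r \<notin> A" "\<forall>b\<in>V - A. d b \<le> d r" by blast
    have "\<exists>E. partial_realization V d (insert r A) (insert r A) E"
      by (rule realize_next_vertex[OF \<open>finite V\<close> A(1) r(1,2) _ even _ E])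
        (use EG[of "insert r A"] A dom r finA in \<open>auto simp: mult.commute\<close>)
    then show ?case
      using A r finA dom by (intro exI[of _ "insert r A"]) auto
  qed
  from this[of "card V"] obtain A E where "A \<subseteq> V" "card A = card V" "partial_realization V d A A E"
    by auto
  moreover then have "A = V" using \<open>finite V\<close> card_subset_eq by blast
  ultimately show ?thesis by (auto simp: partial_realization_def)
qed

section \<open>Sums of entries and the \<open>p\<close>-norm\<close>

text \<open>Power mean inequality, that is, Hoelder's inequality against the constant 1. It is
  Jensen's inequality for the convex function \<open>t powr q\<close> with equal weights
  \<open>1 / c\<close>, followed by a \<open>q\<close>-th root.\<close>

lemma sum_le_card_powr_mult_powr_sum:
  fixes x :: "'a \<Rightarrow> real"
  assumes "finite A" and "1 \<le> q" and pos: "\<And>i. i \<in> A \<Longrightarrow> 0 < x i"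
  shows "(\<Sum>i\<in>A. x i) \<le> real (card A) powr (1 - 1 / q) * (\<Sum>i\<in>A. x i powr q) powr (1 / q)"
proof (cases "A = {}")
  case False
  define c where "c = real (card A)"
  define S where "S = (\<Sum>i\<in>A. x i)"
  have c: "c > 0" using False assms(1) by (simp add: c_def card_gt_0_iff)
  have S: "S > 0" unfolding S_def using False assms(1) pos by (intro sum_pos) auto
  have "(\<Sum>i\<in>A. (1 / c) *\<^sub>R x i) powr q \<le> (\<Sum>i\<in>A. (1 / c) * x i powr q)"
    using assms False c
    by (intro convex_on_sum[OF _ _ powr_convex]) (auto simp: c_def)
  then have "(S / c) powr q \<le> (\<Sum>i\<in>A. x i powr q) / c"
    by (simp add: S_def sum_divide_distrib)
  then have "((S / c) powr q) powr (1 / q) \<le> ((\<Sum>i\<in>A. x i powr q) / c) powr (1 / q)"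
    using assms(2) by (intro powr_mono2) auto
  then have "S / c \<le> (\<Sum>i\<in>A. x i powr q) powr (1 / q) / c powr (1 / q)"
    using assms(2) S c by (simp add: powr_powr powr_divide sum_nonneg)
  then show ?thesis
    using c by (simp add: powr_diff S_def[symmetric] c_def[symmetric] field_simps)
qed auto

text \<open>The form in which both parts use the norm. For finite \<open>p\<close> the sum of powers
  over \<open>A\<close> is enlarged to all entries; for \<open>p = \<infinity>\<close> the exponent
  of \<open>card A\<close> is 1 and each entry is at most the maximum.\<close>

lemma sum_nth_le_card_powr_mult_pnorm:
  assumes p: "1 < p" and pos: "\<forall>x\<in>set v. 0 < x" and A: "A \<subseteq> {..<length v}"
  shows "(\<Sum>i\<in>A. v ! i) \<le> real (card A) powr (1 - recip p) * pnorm p v"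
proof (cases p)
  case (real q)
  then have q: "1 < q" using p by (simp add: one_ereal_def)
  have finA: "finite A" using A finite_subset by blast
  have posA: "0 < v ! i" if "i \<in> A" for i
    using A pos that by (auto dest!: subsetD)
  have sum: "(\<Sum>x\<leftarrow>v. \<bar>x\<bar> powr q) = (\<Sum>i<length v. v ! i powr q)"
    using pos by (simp add: sum_list_sum_nth atLeast0LessThan abs_of_pos)
  have "(\<Sum>i\<in>A. v ! i) \<le> real (card A) powr (1 - 1 / q) * (\<Sum>i\<in>A. v ! i powr q) powr (1 / q)"
    using sum_le_card_powr_mult_powr_sum[OF finA less_imp_le[OF q] posA] .
  also have "\<dots> \<le> real (card A) powr (1 - 1 / q) * (\<Sum>i<length v. v ! i powr q) powr (1 / q)"
    using q A by (intro mult_left_mono powr_mono2 sum_mono2 sum_nonneg) auto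
  finally show ?thesis
    using real q sum by (simp add: pnorm_def recip_ereal)
next
  case PInf
  have "v ! i \<le> Max (abs ` set v)" if "i \<in> A" for i
  proof -
    have "\<bar>v ! i\<bar> \<le> Max (abs ` set v)" using A that by (intro Max_ge) auto
    then show ?thesis by simp
  qed
  then have "(\<Sum>i\<in>A. v ! i) \<le> real (card A) * Max (abs ` set v)"
    by (rule sum_bounded_above)
  then show ?thesis using PInf by (simp add: pnorm_def recip_infinity)
qed (use p in auto)

lemma recip_bounds: "1 < p \<Longrightarrow> 0 \<le> recip p \<and> recip p < 1"
  by (cases p) (auto simp: recip_infinity recip_ereal one_ereal_def)

text \<open>Nonemptiness matters for \<open>p = \<infinity>\<close>, as the maximum of the empty set
  is an unspecified value.\<close>

lemma pnorm_nonneg: "v \<noteq> [] \<Longrightarrow> 0 \<le> pnorm p v"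
proof -
  assume "v \<noteq> []"
  then have "\<bar>hd v\<bar> \<le> Max (abs ` set v)" by (intro Max_ge) auto
  then show ?thesis by (auto simp: pnorm_def)
qed

section \<open>Matchings\<close>

text \<open>The matching grows one edge at a time. Fewer than \<open>m\<close> edges cover fewer
  than \<open>2 * m\<close> vertices; if every edge met this set, its degree sum would be at least
  the number of edges, against \<open>cover\<close>.\<close>

lemma ex_matching_card:
  assumes sg: "simple_graph G"
    and cover: "\<And>C. C \<subseteq> fst G \<Longrightarrow> card C < 2 * m \<Longrightarrow> (\<Sum>v\<in>C. vertex_degree G v) < card (snd G)"
  shows "\<exists>M. is_matching G M \<and> card M = m"
proof -
  obtain V E where G: "G = (V, E)" by fastforce
  have fin: "finite E" and finV: "finite V"
    using sg simple_graph_finite_edges by (auto simp: G simple_graph_def)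
  have "\<exists>M. is_matching G M \<and> card M = k" if "k \<le> m" for k
    using that
  proof (induction k)
    case 0
    then show ?case by (intro exI[of _ "{}"]) (simp add: is_matching_def)
  next
    case (Suc k)
    then obtain M where M: "M \<subseteq> E" "pairwise disjnt M" "card M = k"
      by (auto simp: is_matching_def G)
    have finM: "finite M" using M fin finite_subset by blast
    have "card (\<Union>M) \<le> sum card M" by (rule card_Union_le_sum_card_weak)
      (use M sg in \<open>auto simp: G simple_graph_def intro: finite_subset\<close>)
    also have "\<dots> = 2 * k" using M sg by (auto simp: G simple_graph_def subset_iff)
    also have "\<dots> < 2 * m" using Suc.prems by simp
    finally have small: "(\<Sum>v\<in>\<Union>M. vertex_degree G v) < card E"
      using cover[of "\<Union>M"] M sg by (fastforce simp: G simple_graph_def)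
    have finU: "finite (\<Union>M)" using M finV sg by (intro finite_subset[OF _ finV])
      (auto simp: G simple_graph_def)
    have "\<exists>e\<in>E. e \<inter> \<Union>M = {}"
    proof (rule ccontr)
      assume "\<not> (\<exists>e\<in>E. e \<inter> \<Union>M = {})"
      then have "E \<subseteq> (\<Union>v\<in>\<Union>M. {e \<in> E. v \<in> e})" by blast
      then have "card E \<le> card (\<Union>v\<in>\<Union>M. {e \<in> E. v \<in> e})"
        by (intro card_mono finite_subset[OF _ fin]) auto
      also have "\<dots> \<le> (\<Sum>v\<in>\<Union>M. vertex_degree G v)"
        unfolding vertex_degree_def G snd_conv by (intro card_UN_le finU)
      finally show False using small by simp
    qed
    then obtain e where e: "e \<in> E" "e \<inter> \<Union>M = {}" by blast
    then have "e \<noteq> {}" using sg by (auto simp: G simple_graph_def)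
    then have "e \<notin> M" using e by auto
    then show ?case
      using e M finM by (intro exI[of _ "insert e M"])
        (auto simp: is_matching_def G pairwise_insert disjnt_def)
  qed
  then show ?thesis by blast
qed

lemma dpg_graphic_imp_graphic:
  assumes dpg: "dpg_graphic G d" and deg: "has_degree_sequence G D"
  shows "graphic (D @ [d])"
proof -
  define n where "n = length D"
  obtain E where G: "G = ({..<n}, E)"
    using deg by (cases G) (auto simp: has_degree_sequence_def n_def)
  obtain M where M: "M \<subseteq> E" "pairwise disjnt M" "card M = d div 2" and "even d"
    and sg: "simple_graph ({..<n}, E)"
    using dpg by (auto simp: dpg_graphic_def is_matching_def G)
  have fin: "finite E" by (rule simple_graph_finite_edges[OF sg])
  have finM: "finite M" using M fin finite_subset by blast
  have edge: "e \<subseteq> {..<n}" "card e = 2" if "e \<in> E" for e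
    using sg that by (auto simp: simple_graph_def)
  have UM: "\<Union>M \<subseteq> {..<n}" using edge M by blast
  \<comment> \<open>The old vertices are numbered below \<open>n\<close>, so \<open>n\<close> is the
    new vertex. The matching covers \<open>2 * (d div 2) = d\<close> vertices, which gives
    \<open>n\<close> its degree.\<close>
  define F where "F = (\<lambda>v. {n, v}) ` \<Union>M"
  have finF: "finite F" unfolding F_def using UM by (intro finite_imageI) (auto intro: finite_subset)
  have inj: "inj_on (\<lambda>v. {n, v}) (\<Union>M)"
    by (auto simp: inj_on_def doubleton_eq_iff)
  have "card (\<Union>M) = sum card M"
    using M edge by (intro card_Union_disjoint) (auto intro: finite_subset)
  also have "\<dots> = d" using M edge \<open>even d\<close> by (auto simp: subset_iff)
  finally have cF: "card F = d" unfolding F_def by (simp add: card_image[OF inj])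
  define H where "H = ({..<Suc n}, (E - M) \<union> F)"
  have "simple_graph H"
    unfolding simple_graph_def
  proof (intro conjI ballI)
    fix e assume "e \<in> snd H"
    then consider "e \<in> E" | v where "v \<in> \<Union>M" "e = {n, v}" by (auto simp: H_def F_def)
    then have "e \<subseteq> {..<Suc n} \<and> card e = 2"
    proof cases
      case 1
      then show ?thesis using edge[of e] by (auto simp: less_Suc_eq)
    next
      case 2
      then have "v < n" using UM by auto
      then show ?thesis using 2 by auto
    qed
    then show "e \<subseteq> fst H" "card e = 2" by (auto simp: H_def)
  qed (simp add: H_def)
  moreover have "has_degree_sequence H (D @ [d])"
    unfolding has_degree_sequence_def
  proof (intro conjI allI impI)
    show "fst H = {..<length (D @ [d])}" by (simp add: H_def n_def)
    fix l assume l: "l < length (D @ [d])"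
    show "vertex_degree H l = (D @ [d]) ! l"
    proof (cases "l = n")
      case True
      then have "{e \<in> snd H. l \<in> e} = F" using edge by (auto simp: H_def F_def)
      then show ?thesis using True cF by (simp add: vertex_degree_def n_def)
    next
      case False
      then have l: "l < n" using l by (simp add: n_def)
      \<comment> \<open>An old vertex loses at most one matching edge, by disjointness, and gains
        exactly as many edges to \<open>n\<close> as it loses.\<close>
      have one: "card {e \<in> M. l \<in> e} = card {e \<in> F. l \<in> e}"
      proof (cases "l \<in> \<Union>M")
        case True
        then obtain e where e: "e \<in> M" "l \<in> e" by blast
        have "{e \<in> M. l \<in> e} = {e}"
          using M(2) e by (auto simp: pairwise_def disjnt_def)
        moreover have "{e \<in> F. l \<in> e} = {{n, l}}"
          using True l by (auto simp: F_def)
        ultimately show ?thesis by simp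
      next
        case False
        then have "{e \<in> M. l \<in> e} = {}" "{e \<in> F. l \<in> e} = {}"
          using l by (auto simp: F_def)
        then show ?thesis by (simp only:)
      qed
      have "{e \<in> snd H. l \<in> e} = ({e \<in> E. l \<in> e} - {e \<in> M. l \<in> e}) \<union> {e \<in> F. l \<in> e}"
        by (auto simp: H_def)
      moreover have "({e \<in> E. l \<in> e} - {e \<in> M. l \<in> e}) \<inter> {e \<in> F. l \<in> e} = {}"
        using edge by (fastforce simp: F_def)
      moreover have "{e \<in> M. l \<in> e} \<subseteq> {e \<in> E. l \<in> e}" using M by auto
      ultimately have "vertex_degree H l = card {e \<in> E. l \<in> e} - card {e \<in> M. l \<in> e} + card {e \<in> F. l \<in> e}"
        using fin finM finF by (simp add: vertex_degree_def card_Un_disjoint card_Diff_subset)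
      also have "\<dots> = card {e \<in> E. l \<in> e}"
        using one card_mono[OF _ \<open>{e \<in> M. l \<in> e} \<subseteq> {e \<in> E. l \<in> e}\<close>] fin by simp
      also have "\<dots> = D ! l"
        using deg l by (simp add: has_degree_sequence_def vertex_degree_def G n_def)
      finally show ?thesis using l by (simp add: n_def nth_append)
    qed
  qed
  ultimately show ?thesis unfolding graphic_def by blast
qed

section \<open>Norm conditions\<close>

text \<open>A weighted geometric mean increases when both arguments are replaced by their
  maximum.\<close>

lemma powr_mult_powr_le_max:
  fixes x y :: real
  assumes "0 \<le> x" "0 \<le> y" "0 \<le> a" "a \<le> 1"
  shows "x powr a * y powr (1 - a) \<le> max x y"
proof -
  have "x powr a * y powr (1 - a) \<le> max x y powr a * max x y powr (1 - a)"
    using assms by (intro mult_mono powr_mono2) auto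
  also have "\<dots> = max x y" using assms by (simp add: powr_add[symmetric])
  finally show ?thesis .
qed

lemma graphic_if_pnorm_le:
  assumes pos: "\<forall>k\<in>set D. 0 < k" and even: "even (sum_list D)" and p: "1 < p"
    and bound: "pnorm p (map (\<lambda>k. 2 + real k) D) \<le> real (length D) powr (1/2 + recip p / 2)"
  shows "graphic D"
proof -
  define n where "n = length D"
  \<comment> \<open>With this \<open>a\<close>, the exponents \<open>1 - recip p\<close> and
    \<open>1/2 + recip p / 2\<close> become \<open>2 * a\<close> and \<open>1 - a\<close>, so the
    Hoelder bound is a weighted geometric mean of \<open>k ^ 2\<close> and \<open>n\<close>.\<close>
  define a where "a = (1 - recip p) / 2"
  have a: "0 \<le> a" "a \<le> 1" using recip_bounds[OF p] by (auto simp: a_def)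
  have "\<exists>E. simple_graph ({..<n}, E) \<and> (\<forall>v\<in>{..<n}. vertex_degree ({..<n}, E) v = D ! v)"
  proof (rule erdos_gallai_sufficient)
    show "even (\<Sum>v<n. D ! v)"
      using even by (simp add: sum_list_sum_nth n_def atLeast0LessThan)
    fix A assume A: "A \<subseteq> {..<n}"
    then have finA: "finite A" using finite_subset by blast
    define k where "k = card A"
    have kn: "k \<le> n" using card_mono[OF _ A] by (simp add: k_def)
    show "(\<Sum>v\<in>A. D ! v) \<le> card A * (card A - 1) + (\<Sum>v\<in>{..<n} - A. min (card A) (D ! v))"
    proof (cases "A = {}")
      case False
      then have k: "0 < k" using finA by (simp add: k_def card_gt_0_iff)
      have "real (\<Sum>v\<in>A. D ! v) + 2 * real k = (\<Sum>v\<in>A. map (\<lambda>k. 2 + real k) D ! v)"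
        using A by (subst sum.cong[OF refl nth_map]) (auto simp: n_def sum.distrib k_def)
      also have "\<dots> \<le> real k powr (1 - recip p) * pnorm p (map (\<lambda>k. 2 + real k) D)"
        unfolding k_def using A p
        by (intro sum_nth_le_card_powr_mult_pnorm) (auto simp: n_def)
      also have "\<dots> \<le> real k powr (1 - recip p) * real n powr (1/2 + recip p / 2)"
        using bound by (intro mult_left_mono) (auto simp: n_def)
      also have "\<dots> = (real k ^ 2) powr a * real n powr (1 - a)"
      proof -
        have e: "1 - recip p = 2 * a" "1/2 + recip p / 2 = 1 - a"
          by (auto simp: a_def field_simps)
        have "real k ^ 2 = real k powr 2" using k by simp
        then show ?thesis unfolding e by (simp only: powr_powr)
      qed
      also have "\<dots> \<le> max (real k ^ 2) (real n)"
        using a by (intro powr_mult_powr_le_max) auto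
      also have "\<dots> \<le> real (k ^ 2 + n)" by simp
      finally have "(\<Sum>v\<in>A. D ! v) + 2 * k \<le> k ^ 2 + n" by linarith
      \<comment> \<open>The \<open>2 * k\<close> coming from the shift by 2 in the norm is split
        evenly between the two terms; \<open>kn\<close> keeps \<open>n - k\<close> from
        truncating.\<close>
      then have "(\<Sum>v\<in>A. D ! v) \<le> k * (k - 1) + (n - k)"
        using kn k by (cases k) (auto simp: power2_eq_square)
      also have "n - k = (\<Sum>v\<in>{..<n} - A. 1)"
        using A finA by (simp add: card_Diff_subset k_def)
      also have "\<dots> \<le> (\<Sum>v\<in>{..<n} - A. min k (D ! v))"
        using k pos by (intro sum_mono) (auto simp: n_def Suc_le_eq)
      finally show ?thesis by (simp add: k_def)
    qed simp
  qed simp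
  then obtain E where "simple_graph ({..<n}, E)" "\<forall>v<n. vertex_degree ({..<n}, E) v = D ! v"
    by auto
  then show ?thesis
    unfolding graphic_def has_degree_sequence_def
    by (intro exI[of _ "({..<n}, E)"]) (auto simp: n_def)
qed

lemma dpg_graphic_if_pnorm_le:
  assumes "D \<noteq> []" and pos: "\<forall>k\<in>set D. 0 < k" and p: "1 < p"
    and sg: "simple_graph G" and deg: "has_degree_sequence G D" and d: "2 \<le> d" "even d"
    and bound: "4 * real d powr (1 - recip p) * pnorm p (map real D) \<le> pnorm 1 (map real D)"
  shows "dpg_graphic G d"
proof -
  define n where "n = length D"
  obtain E where G: "G = ({..<n}, E)"
    using deg by (cases G) (auto simp: has_degree_sequence_def n_def)
  have degD: "vertex_degree G v = D ! v" if "v < n" for v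
    using deg that by (simp add: has_degree_sequence_def n_def)
  have "2 * card E = sum_list D"
    using sum_vertex_degree[of "{..<n}" E] sg degD
    by (simp add: G sum_list_sum_nth atLeast0LessThan n_def)
  moreover have "0 < sum_list D"
    using \<open>D \<noteq> []\<close> pos by (cases D) auto
  ultimately have edges: "2 * card E = sum_list D" "0 < card E" by auto
  have "\<exists>M. is_matching G M \<and> card M = d div 2"
  proof (rule ex_matching_card[OF sg])
    fix C assume C: "C \<subseteq> fst G" "card C < 2 * (d div 2)"
    then have Cn: "C \<subseteq> {..<n}" by (simp add: G)
    have "real (\<Sum>v\<in>C. vertex_degree G v) = (\<Sum>v\<in>C. map real D ! v)"
      using Cn degD by (subst sum.cong[OF refl nth_map]) (auto simp: n_def subset_iff)
    also have "\<dots> \<le> real (card C) powr (1 - recip p) * pnorm p (map real D)"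
      using Cn pos p by (intro sum_nth_le_card_powr_mult_pnorm) (auto simp: n_def)
    also have "\<dots> \<le> real d powr (1 - recip p) * pnorm p (map real D)"
      using C recip_bounds[OF p] \<open>D \<noteq> []\<close>
      by (intro mult_right_mono powr_mono2 pnorm_nonneg) auto
    \<comment> \<open>As \<open>sum_list D\<close> equals \<open>2 * card E\<close>, the factor 4
      leaves at most half of \<open>card E\<close>, which is strictly smaller than
      \<open>card E\<close> because there is at least one edge.\<close>
    also have "\<dots> \<le> real (sum_list D) / 4" using bound by (simp add: pnorm_1)
    also have "\<dots> < real (card E)" using edges by simp
    finally have "(\<Sum>v\<in>C. vertex_degree G v) < card E" by (simp only: of_nat_less_iff)
    then show "(\<Sum>v\<in>C. vertex_degree G v) < card (snd G)" by (simp add: G)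
  qed
  then show ?thesis using sg d by (auto simp: dpg_graphic_def)
qed

theorem theorem1p7:
  fixes D :: "nat list" and p :: ereal
  assumes "D \<noteq> []"
    and "\<forall>k\<in>set D. 0 < k"
    and "even (sum_list D)"
    and "1 < p" and "p \<le> \<infinity>"
  shows "(pnorm p (map (\<lambda>k. 2 + real k) D) \<le> real (length D) powr (1/2 + recip p / 2)
            \<longrightarrow> (\<exists>G. simple_graph G \<and> has_degree_sequence G D)) \<and>
         (\<forall>(G :: nat ugraph) (d :: nat).
            simple_graph G \<and> has_degree_sequence G D \<and> 2 \<le> d \<and> even d \<and>
            4 * real d powr (1 - recip p) * pnorm p (map real D) \<le> pnorm 1 (map real D)
            \<longrightarrow> dpg_graphic G d \<and> graphic (D @ [d]))"
proof (intro conjI allI impI)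
  assume "pnorm p (map (\<lambda>k. 2 + real k) D) \<le> real (length D) powr (1/2 + recip p / 2)"
  with graphic_if_pnorm_le[OF assms(2-4)]
  show "\<exists>G. simple_graph G \<and> has_degree_sequence G D" unfolding graphic_def .
next
  fix G d
  assume asm: "simple_graph G \<and> has_degree_sequence G D \<and> 2 \<le> d \<and> even d \<and>
    4 * real d powr (1 - recip p) * pnorm p (map real D) \<le> pnorm 1 (map real D)"
  then show dpg: "dpg_graphic G d"
    using dpg_graphic_if_pnorm_le[OF assms(1,2,4)] by simp
  show "graphic (D @ [d])"
    using dpg_graphic_imp_graphic[OF dpg] asm by simp
qed

end
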